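(* Let $f\in\Gamma_0(\mathcal X)$, $x^\star=\mathrm{Proj}_{\mathcal X^\star}(x)$, $\beta=(\beta_x,\beta_y)\in(0,+\infty)^2$ and $\beta_{\min}=\min(\beta_x,\beta_y)$. Assume the quadratic error bound of the smoothed gap: there are $\eta>0$ and a region $\mathcal R\subseteq\mathcal Z$ such that $\mathcal G_\beta(z)\ge\frac{\eta}{2}\,\mathrm{dist}(z,\mathcal Z^\star)^2$ for all $z\in\mathcal R$. Then for all $z=(x,y)\in\mathcal Z$, $$f(x)-f_{\mathrm{opt}}\ \le\ \left(1+\|x\|+\sqrt{\tfrac{2}{\eta}}\sqrt{(1+\|x\|+\|y\|)\sqrt{\mathcal D(z)}+\tfrac{1}{2\beta_{\min}}\mathcal D(z)}\right)\sqrt{\mathcal D(z)} .$$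
   Context: $\mathcal X,\mathcal Y$ are Euclidean spaces, $\mathcal Z=\mathcal X\times\mathcal Y$, $z=(x,y)$. $\Gamma_0(\mathcal X)$ is the set of proper, lower semicontinuous, convex functions $\mathcal X\to\mathbb R\cup\{+\infty\}$. $A:\mathcal X\to\mathcal Y$ is linear with adjoint $A^T$, and $b\in\mathcal Y$. The problem is $\min_x f(x)$ subject to $Ax=b$, with optimal value $f_{\mathrm{opt}}=f(x^\star)$, set of primal solutions $\mathcal X^\star$, and Lagrangian $\mathcal L(x,y)=f(x)+\langle Ax-b,y\rangle$. It is assumed throughout that $\mathcal L$ has a saddle point; $\mathcal Z^\star$ is the set of saddle points. $f^*(\mu)=\sup_x\langle\mu,x\rangle-f(x)$ is the Fenchel conjugate. The self-centered smoothed duality gap is $$\mathcal G_\beta(z)=f(x)-f(p)+\langle A(x-p),y\rangle-\tfrac{\beta_x}{2}\|p-x\|^2+\tfrac1{2\beta_y}\|Ax-b\|^2,\qquad p=\mathrm{Prox}_{\beta_x^{-1}f}\big(x-\tfrac1{\beta_x}A^Ty\big),$$ where $\mathrm{Prox}_{sf}(x)=\arg\min_{x'}f(x')+\frac1{2s}\|x'-x\|^2$. The projected duality gap is $$\mathcal D(z)=|f(x)+f^*(a)+\langle b,y\rangle|^2+\|a+A^Ty\|^2+\|Ax-b\|^2,\qquad a=\mathrm{Proj}_{\mathrm{dom} f^*}(-A^Ty).$$ $\mathrm{dist}(u,S)=\min_{s\in S}\|u-s\|$ and $\mathrm{Proj}_S$ is the Euclidean projection onto $S$.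
   Formalization: The inequality is proved for all z in the region R where the error bound is assumed, not for all z in Z; for arbitrary R the claim on all of Z is false (f(x)=max(0,100-x), A=1/100, b=1, z=(0,-100), R a small ball around (100,50), η large). *)

theory Defs
  imports "HOL-Analysis.Analysis"
begin

text \<open>
  Functions with values in \<open>\<real> \<union> {+\<infinity>}\<close> are rendered as \<^typ>\<open>ereal\<close>-valued functions that never
  take the value \<open>-\<infinity>\<close>; the gaps and the optimal value are \<^typ>\<open>ereal\<close>-valued as well.
\<close>

definition ereal_proper :: "('a \<Rightarrow> ereal) \<Rightarrow> bool" where
  "ereal_proper f \<longleftrightarrow> (\<forall>x. f x \<noteq> -\<infinity>) \<and> (\<exists>x. f x \<noteq> \<infinity>)"

definition lower_semicont :: "('a::topological_space \<Rightarrow> ereal) \<Rightarrow> bool" where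
  "lower_semicont f \<longleftrightarrow> (\<forall>x. f x \<le> Liminf (at x) f)"

text \<open>
  At the endpoints \<open>t = 0\<close> and \<open>t = 1\<close> the inequality below holds trivially, because
  \<open>0 * \<infinity> = 0\<close> in \<^typ>\<open>ereal\<close>.
\<close>

definition ereal_convex :: "('a::real_vector \<Rightarrow> ereal) \<Rightarrow> bool" where
  "ereal_convex f \<longleftrightarrow> (\<forall>x y. \<forall>t\<in>{0..1::real}.
     f ((1 - t) *\<^sub>R x + t *\<^sub>R y) \<le> ereal (1 - t) * f x + ereal t * f y)"

definition Gamma0 :: "('a::euclidean_space \<Rightarrow> ereal) set" where
  "Gamma0 = {f. ereal_proper f \<and> lower_semicont f \<and> ereal_convex f}"

definition effective_domain :: "('a \<Rightarrow> ereal) \<Rightarrow> 'a set" where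
  "effective_domain f = {x. f x < \<infinity>}"

definition fenchel_conj :: "('a::real_inner \<Rightarrow> ereal) \<Rightarrow> 'a \<Rightarrow> ereal" where
  "fenchel_conj f \<mu> = (SUP x. ereal (\<mu> \<bullet> x) - f x)"

definition prox :: "real \<Rightarrow> ('a::real_normed_vector \<Rightarrow> ereal) \<Rightarrow> 'a \<Rightarrow> 'a" where
  "prox s f x = arg_min (\<lambda>x'. f x' + ereal (1 / (2 * s) * (norm (x' - x))\<^sup>2)) (\<lambda>_. True)"

definition optimal_value :: "('a \<Rightarrow> ereal) \<Rightarrow> ('a \<Rightarrow> 'b) \<Rightarrow> 'b \<Rightarrow> ereal" where
  "optimal_value f A b = (INF x\<in>{x. A x = b}. f x)"

definition lagrangian ::
  "('a \<Rightarrow> ereal) \<Rightarrow> ('a \<Rightarrow> 'b::real_inner) \<Rightarrow> 'b \<Rightarrow> 'a \<Rightarrow> 'b \<Rightarrow> ereal" where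
  "lagrangian f A b x y = f x + ereal ((A x - b) \<bullet> y)"

definition saddle_points ::
  "('a \<Rightarrow> ereal) \<Rightarrow> ('a \<Rightarrow> 'b::real_inner) \<Rightarrow> 'b \<Rightarrow> ('a \<times> 'b) set" where
  "saddle_points f A b = {(xs, ys). \<forall>x y.
     lagrangian f A b xs y \<le> lagrangian f A b xs ys \<and>
     lagrangian f A b xs ys \<le> lagrangian f A b x ys}"

definition smoothed_gap ::
  "('a::euclidean_space \<Rightarrow> ereal) \<Rightarrow> ('a \<Rightarrow> 'b::euclidean_space) \<Rightarrow> 'b \<Rightarrow> real \<Rightarrow> real
     \<Rightarrow> 'a \<times> 'b \<Rightarrow> ereal" where
  "smoothed_gap f A b \<beta>x \<beta>y z = (let x = fst z; y = snd z;
       p = prox (1 / \<beta>x) f (x - (1 / \<beta>x) *\<^sub>R adjoint A y)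
     in f x - f p + ereal (A (x - p) \<bullet> y - \<beta>x / 2 * (norm (p - x))\<^sup>2
          + 1 / (2 * \<beta>y) * (norm (A x - b))\<^sup>2))"

text \<open>
  The effective domain of the conjugate is convex and nonempty but need not be closed.  Where the
  projection of \<open>- A\<^sup>T y\<close> onto it is not attained, \<^const>\<open>closest_point\<close> returns an unspecified
  vector.
\<close>

definition projected_gap ::
  "('a::euclidean_space \<Rightarrow> ereal) \<Rightarrow> ('a \<Rightarrow> 'b::euclidean_space) \<Rightarrow> 'b \<Rightarrow> 'a \<times> 'b \<Rightarrow> ereal" where
  "projected_gap f A b z = (let x = fst z; y = snd z;
       a = closest_point (effective_domain (fenchel_conj f)) (- adjoint A y)
     in \<bar>f x + fenchel_conj f a + ereal (b \<bullet> y)\<bar>\<^sup>2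
        + ereal ((norm (a + adjoint A y))\<^sup>2) + ereal ((norm (A x - b))\<^sup>2))"

text \<open>Only used for nonnegative arguments.\<close>

definition ereal_sqrt :: "ereal \<Rightarrow> ereal" where
  "ereal_sqrt u = (if u = \<infinity> then \<infinity> else ereal (sqrt (real_of_ereal u)))"

end

theory Submission
  imports Defs
begin

text \<open>
  Write \<open>r = f x + f\<^sup>* a + \<langle>b, y\<rangle>\<close>, \<open>e = a + A\<^sup>T y\<close> and \<open>g = A x - b\<close>; each of these is bounded by the
  square root of the projected gap \<open>D\<close>.  The Fenchel--Young inequality for \<open>a\<close> and \<open>p\<close> bounds the smoothed
  gap by \<open>r + \<langle>g, y\<rangle> - \<langle>e, x\<rangle> + \<langle>e, x - p\<rangle> - \<beta>x / 2 \<parallel>x - p\<parallel>\<^sup>2 + \<parallel>g\<parallel>\<^sup>2 / (2 \<beta>y)\<close>, in which the terms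
  containing \<open>x - p\<close> are at most \<open>\<parallel>e\<parallel>\<^sup>2 / (2 \<beta>x)\<close>.  Hence the error bound controls the distance to
  the saddle points by \<open>D\<close>.  The Fenchel--Young inequality for \<open>a\<close> and the primal part \<open>u\<close> of a saddle point
  gives \<open>f x - f u \<le> r - \<langle>e, u\<rangle>\<close>, and \<open>\<parallel>u\<parallel> \<le> \<parallel>x\<parallel> + \<parallel>x - u\<parallel>\<close>.

  The argument works for arbitrary vectors \<open>a\<close> and \<open>p\<close>, hence also where the projection is not
  attained and \<open>closest_point\<close> returns an unspecified value.
\<close>

lemma fenchel_young: "ereal (a \<bullet> u) - f u \<le> fenchel_conj f a"
  unfolding fenchel_conj_def by (rule SUP_upper) simp

text \<open>One point where \<open>f\<close> is finite bounds the supremum from below by a real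
  number. This rules out \<infinity> + (-\<infinity>) inside the projected gap.\<close>

lemma fenchel_conj_not_MInfty:
  assumes "ereal_proper f"
  shows "fenchel_conj f a \<noteq> -\<infinity>"
proof -
  obtain u where u: "f u \<noteq> \<infinity>" "f u \<noteq> -\<infinity>"
    using assms by (auto simp: ereal_proper_def)
  have "ereal (a \<bullet> u) - f u \<noteq> -\<infinity>"
    using u by (cases "f u") auto
  then show ?thesis
    using fenchel_young[of a u f] by auto
qed

text \<open>Minimality in the primal variable, tested at a point of the domain, makes
  \<open>f u\<close> finite. Once \<open>u\<close> is known to be feasible, the Lagrangian equals
  \<open>f\<close> on the feasible set, and the same minimality gives optimality.\<close>

lemma saddle_point_primal:
  assumes f: "ereal_proper f" and s: "(u, v) \<in> saddle_points f A b"
  shows "A u = b" and "\<bar>f u\<bar> \<noteq> \<infinity>" and "optimal_value f A b = f u"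
proof -
  have L1: "lagrangian f A b u y \<le> lagrangian f A b u v"
    and L2: "lagrangian f A b u v \<le> lagrangian f A b x v" for x y
    using s by (auto simp: saddle_points_def)
  obtain w where w: "f w \<noteq> \<infinity>"
    using f by (auto simp: ereal_proper_def)
  have "f u \<noteq> \<infinity>"
    using L2[of w] w by (auto simp: lagrangian_def)
  moreover have "f u \<noteq> -\<infinity>"
    using f by (simp add: ereal_proper_def)
  ultimately show "\<bar>f u\<bar> \<noteq> \<infinity>"
    by (cases "f u") auto
  then obtain c where c: "f u = ereal c"
    by (cases "f u") auto
  \<comment> \<open>Moving the dual variable from \<open>v\<close> along the residual turns
    maximality into a bound on the squared norm of that residual; \<open>f u\<close> cancels because
    it is finite.\<close>
  have "(A u - b) \<bullet> (v + (A u - b)) \<le> (A u - b) \<bullet> v"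
    using L1[of "v + (A u - b)"] by (simp add: lagrangian_def c)
  then have "(A u - b) \<bullet> (A u - b) \<le> 0"
    by (simp add: inner_add_right)
  then have "A u - b = 0"
    by (metis inner_eq_zero_iff inner_ge_zero order_antisym)
  then show Au: "A u = b"
    by simp
  have "f u \<le> f x" if "A x = b" for x
    using L2[of x] that Au by (simp add: lagrangian_def flip: zero_ereal_def)
  then show "optimal_value f A b = f u"
    unfolding optimal_value_def
    by (intro antisym INF_greatest INF_lower2[of u]) (auto simp: Au)
qed

lemma smoothed_gap_le:
  fixes A :: "'a::euclidean_space \<Rightarrow> 'b::euclidean_space"
  assumes f: "ereal_proper f" and A: "linear A"
    and \<beta>: "\<beta>x > 0"
    and fx: "f x = ereal \<phi>" and c: "fenchel_conj f a = ereal c"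
  shows "smoothed_gap f A b \<beta>x \<beta>y (x, y) \<le>
    ereal (\<phi> + c + b \<bullet> y + (A x - b) \<bullet> y - (a + adjoint A y) \<bullet> x
           + 1 / (2 * \<beta>x) * (norm (a + adjoint A y))\<^sup>2 + 1 / (2 * \<beta>y) * (norm (A x - b))\<^sup>2)"
proof -
  define p where "p = prox (1 / \<beta>x) f (x - (1 / \<beta>x) *\<^sub>R adjoint A y)"
  define e where "e = a + adjoint A y"
  have gap: "smoothed_gap f A b \<beta>x \<beta>y (x, y) = ereal \<phi> - f p
      + ereal (A (x - p) \<bullet> y - \<beta>x / 2 * (norm (p - x))\<^sup>2 + 1 / (2 * \<beta>y) * (norm (A x - b))\<^sup>2)"
    by (simp add: smoothed_gap_def Let_def p_def fx)
  show ?thesis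
  proof (cases "f p")
    case (real \<psi>)
    have FY: "a \<bullet> p - \<psi> \<le> c"
      using fenchel_young[of a p f] by (simp add: real c)
    have adj: "A w \<bullet> y = adjoint A y \<bullet> w" for w
      by (simp add: adjoint_clauses[OF A] inner_commute)
    have Axp: "A (x - p) \<bullet> y = A x \<bullet> y - adjoint A y \<bullet> p"
      using A by (simp add: linear_diff inner_diff_left adj)
    \<comment> \<open>Completing the square: dividing the expansion by \<open>2 * \<beta>x\<close>
      bounds the terms in \<open>x - p\<close>, with equality when \<open>x - p\<close> is
      \<open>e\<close> divided by \<open>\<beta>x\<close>.\<close>
    have "0 \<le> (norm (e - \<beta>x *\<^sub>R (x - p)))\<^sup>2"
      by simp
    also have "\<dots> = (norm e)\<^sup>2 - 2 * \<beta>x * (e \<bullet> (x - p)) + \<beta>x\<^sup>2 * (norm (p - x))\<^sup>2"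
      by (simp only: power2_norm_eq_inner) (simp add: algebra_simps inner_commute power2_eq_square)
    finally have "e \<bullet> (x - p) - \<beta>x / 2 * (norm (p - x))\<^sup>2 \<le> 1 / (2 * \<beta>x) * (norm e)\<^sup>2"
      using \<beta> by (simp add: field_simps power2_eq_square)
    \<comment> \<open>\<open>FY\<close> contributes \<open>- (a \<bullet> p)\<close>, which joins
      the adjoint term to form \<open>- (e \<bullet> p)\<close>, that is,
      \<open>- (e \<bullet> x) + e \<bullet> (x - p)\<close>.\<close>
    then show ?thesis
      using FY unfolding gap e_def[symmetric]
      by (simp add: real Axp) (simp add: e_def algebra_simps inner_commute adj)
  next
    \<comment> \<open>The gap is then \<open>-\<infinity>\<close>.\<close>
    case PInf
    then show ?thesis by (simp add: gap)
  next
    case MInf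
    then show ?thesis using f by (simp add: ereal_proper_def)
  qed
qed

text \<open>Feasibility of \<open>u\<close> lets \<open>b \<bullet> y\<close> cancel the adjoint
  part of the inner product. What remains, \<open>\<phi> + c - a \<bullet> u\<close>, is bounded
  below by Fenchel--Young.\<close>

lemma primal_gap_le:
  fixes A :: "'a::euclidean_space \<Rightarrow> 'b::euclidean_space"
  assumes f: "ereal_proper f" and A: "linear A"
    and s: "(u, v) \<in> saddle_points f A b"
    and fx: "f x = ereal \<phi>" and c: "fenchel_conj f a = ereal c"
  shows "f x - optimal_value f A b \<le> ereal (\<phi> + c + b \<bullet> y - (a + adjoint A y) \<bullet> u)"
proof -
  obtain \<mu> where \<mu>: "f u = ereal \<mu>"
    using saddle_point_primal(2)[OF f s] by (cases "f u") auto
  have "a \<bullet> u - \<mu> \<le> c"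
    using fenchel_young[of a u f] by (simp add: \<mu> c)
  moreover have "b \<bullet> y = adjoint A y \<bullet> u"
    using saddle_point_primal(1)[OF f s] adjoint_clauses(2)[OF A, of y u] by (simp add: inner_commute)
  ultimately show ?thesis
    by (simp add: saddle_point_primal(3)[OF f s] fx \<mu> inner_add_left)
qed

text \<open>The finite case of the theorem: for the vector \<open>a\<close> of the projected gap,
  the real number \<open>D\<close> is that gap.\<close>

lemma error_bound_estimate:
  fixes A :: "'a::euclidean_space \<Rightarrow> 'b::euclidean_space"
  assumes f: "ereal_proper f" and A: "linear A"
    and saddle: "saddle_points f A b \<noteq> {}"
    and \<beta>: "\<beta>x > 0" "\<beta>y > 0" and \<eta>: "\<eta> > 0"
    and eb: "smoothed_gap f A b \<beta>x \<beta>y (x, y) \<ge> ereal (\<eta> / 2 * (infdist (x, y) (saddle_points f A b))\<^sup>2)"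
    and fx: "f x = ereal \<phi>" and c: "fenchel_conj f a = ereal c"
    and D: "D = (\<phi> + c + b \<bullet> y)\<^sup>2 + (norm (a + adjoint A y))\<^sup>2 + (norm (A x - b))\<^sup>2"
  shows "f x - optimal_value f A b \<le> ereal ((1 + norm x + sqrt (2 / \<eta>) *
     sqrt ((1 + norm x + norm y) * sqrt D + 1 / (2 * min \<beta>x \<beta>y) * D)) * sqrt D)"
proof -
  define r where "r = \<phi> + c + b \<bullet> y"
  define e where "e = a + adjoint A y"
  define g where "g = A x - b"
  define S where "S = saddle_points f A b"
  define G where "G = (1 + norm x + norm y) * sqrt D + 1 / (2 * min \<beta>x \<beta>y) * D"
  have D': "D = r\<^sup>2 + (norm e)\<^sup>2 + (norm g)\<^sup>2"
    by (simp add: D r_def e_def g_def)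
  have r: "\<bar>r\<bar> \<le> sqrt D" and e: "norm e \<le> sqrt D" and g: "norm g \<le> sqrt D"
    by (rule real_le_rsqrt, simp add: D')+
  have D0: "0 \<le> D" by (simp add: D')
  have "ereal (\<eta> / 2 * (infdist (x, y) S)\<^sup>2) \<le> ereal (r + g \<bullet> y - e \<bullet> x
           + 1 / (2 * \<beta>x) * (norm e)\<^sup>2 + 1 / (2 * \<beta>y) * (norm g)\<^sup>2)"
    using eb smoothed_gap_le[OF f A \<beta>(1) fx c, of b \<beta>y y]
    unfolding S_def r_def e_def g_def by (rule order_trans)
  then have "\<eta> / 2 * (infdist (x, y) S)\<^sup>2 \<le> r + g \<bullet> y - e \<bullet> x
           + 1 / (2 * \<beta>x) * (norm e)\<^sup>2 + 1 / (2 * \<beta>y) * (norm g)\<^sup>2"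
    by simp
  also have "\<dots> \<le> sqrt D + sqrt D * norm y + sqrt D * norm x
           + 1 / (2 * min \<beta>x \<beta>y) * (norm e)\<^sup>2 + 1 / (2 * min \<beta>x \<beta>y) * (norm g)\<^sup>2"
  proof -
    have "g \<bullet> y \<le> sqrt D * norm y"
      using norm_cauchy_schwarz[of g y] mult_right_mono[OF g, of "norm y"] by simp
    moreover have "- (e \<bullet> x) \<le> sqrt D * norm x"
      using norm_cauchy_schwarz[of "- e" x] mult_right_mono[OF e, of "norm x"] by simp
    moreover have "1 / (2 * \<beta>x) * (norm e)\<^sup>2 \<le> 1 / (2 * min \<beta>x \<beta>y) * (norm e)\<^sup>2"
      using \<beta> by (intro mult_right_mono divide_left_mono) auto
    moreover have "1 / (2 * \<beta>y) * (norm g)\<^sup>2 \<le> 1 / (2 * min \<beta>x \<beta>y) * (norm g)\<^sup>2"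
      using \<beta> by (intro mult_right_mono divide_left_mono) auto
    ultimately show ?thesis using r by linarith
  qed
  also have "\<dots> \<le> G"
  proof -
    have "1 / (2 * min \<beta>x \<beta>y) * ((norm e)\<^sup>2 + (norm g)\<^sup>2) \<le> 1 / (2 * min \<beta>x \<beta>y) * D"
      using \<beta> by (intro mult_left_mono) (auto simp: D')
    then show ?thesis by (simp add: G_def algebra_simps)
  qed
  finally have "(infdist (x, y) S)\<^sup>2 \<le> 2 / \<eta> * G"
    using \<eta> by (simp add: field_simps)
  then have dist: "infdist (x, y) S \<le> sqrt (2 / \<eta>) * sqrt G"
    unfolding real_sqrt_mult[symmetric] by (rule real_le_rsqrt)
  \<comment> \<open>Proved for every saddle point, so that the infimum over \<open>S\<close> can be
    taken afterwards without choosing a nearest one.\<close>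
  have le: "f x - optimal_value f A b \<le> ereal (sqrt D * (1 + norm x + dist (x, y) s))"
    if "s \<in> S" for s
  proof -
    obtain u v where s: "s = (u, v)" by (cases s)
    have "norm u \<le> norm x + dist x u"
      using norm_triangle_ineq4[of x "x - u"] by (simp add: dist_norm)
    also have "dist x u \<le> dist (x, y) s"
      using dist_fst_le[of "(x, y)" s] by (simp add: s)
    finally have "sqrt D * norm u \<le> sqrt D * (norm x + dist (x, y) s)"
      using D0 by (intro mult_left_mono) auto
    moreover have "- (e \<bullet> u) \<le> sqrt D * norm u"
      using norm_cauchy_schwarz[of "- e" u] mult_right_mono[OF e, of "norm u"] by simp
    ultimately have "r - e \<bullet> u \<le> sqrt D * (1 + norm x + dist (x, y) s)"
      using r by (simp add: algebra_simps)
    moreover have "f x - optimal_value f A b \<le> ereal (r - e \<bullet> u)"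
      using primal_gap_le[OF f A _ fx c, of u v b y] that
      by (simp add: S_def s r_def e_def)
    ultimately show ?thesis
      by (meson ereal_less_eq(3) order_trans)
  qed
  have "f x - optimal_value f A b \<le> ereal (sqrt D * (1 + norm x + infdist (x, y) S))"
  proof -
    obtain u v where uv: "(u, v) \<in> S" using saddle by (auto simp: S_def)
    obtain h where h: "f x - optimal_value f A b = ereal h"
      using saddle_point_primal(2,3)[OF f uv[unfolded S_def]] fx by (cases "f u") auto
    have "h \<le> sqrt D * (1 + norm x + infdist (x, y) S)"
    \<comment> \<open>For \<open>D = 0\<close> the distance drops out of the bound, so any saddle
      point serves; otherwise dividing by \<open>sqrt D\<close> isolates the distance before the
      infimum is taken.\<close>
    proof (cases "D = 0")
      case True
      then show ?thesis using le[OF uv] h by simp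
    next
      case False
      then have pos: "sqrt D > 0" using D0 by simp
      have "h / sqrt D - 1 - norm x \<le> dist (x, y) s" if "s \<in> S" for s
        using le[OF that] pos by (simp add: h field_simps)
      then have "h / sqrt D - 1 - norm x \<le> infdist (x, y) S"
        using uv unfolding infdist_def by (auto intro!: cINF_greatest)
      then show ?thesis using pos by (simp add: field_simps)
    qed
    then show ?thesis by (simp add: h)
  qed
  also have "\<dots> \<le> ereal (sqrt D * (1 + norm x + sqrt (2 / \<eta>) * sqrt G))"
    using dist D0 by (simp add: mult_left_mono)
  finally show ?thesis
    by (simp add: G_def mult.commute)
qed

theorem theorem4:
  fixes f :: "'a::euclidean_space \<Rightarrow> ereal"
    and A :: "'a \<Rightarrow> 'b::euclidean_space"
    and b :: 'b
    and \<beta>x \<beta>y \<beta>min \<eta> :: real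
    and R :: "('a \<times> 'b) set"
  assumes "f \<in> Gamma0"
    and "linear A"
    and "saddle_points f A b \<noteq> {}"
    and "\<beta>x > 0" and "\<beta>y > 0" and "\<beta>min = min \<beta>x \<beta>y"
    and "\<eta> > 0"
    and "\<forall>z\<in>R. smoothed_gap f A b \<beta>x \<beta>y z \<ge> ereal (\<eta> / 2 * (infdist z (saddle_points f A b))\<^sup>2)"
  shows "\<forall>(x, y)\<in>R.
    f x - optimal_value f A b \<le>
      (ereal (1 + norm x) + ereal (sqrt (2 / \<eta>)) *
         ereal_sqrt (ereal (1 + norm x + norm y) * ereal_sqrt (projected_gap f A b (x, y))
                     + ereal (1 / (2 * \<beta>min)) * projected_gap f A b (x, y)))
      * ereal_sqrt (projected_gap f A b (x, y))"
proof clarify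
  fix x y assume z: "(x, y) \<in> R"
  have f: "ereal_proper f" using assms(1) by (simp add: Gamma0_def)
  define a where "a = closest_point (effective_domain (fenchel_conj f)) (- adjoint A y)"
  define P where "P = projected_gap f A b (x, y)"
  have P: "P = \<bar>f x + fenchel_conj f a + ereal (b \<bullet> y)\<bar>\<^sup>2
        + ereal ((norm (a + adjoint A y))\<^sup>2) + ereal ((norm (A x - b))\<^sup>2)"
    by (simp add: P_def projected_gap_def Let_def a_def)
  have nx: "f x \<noteq> -\<infinity>" using f by (simp add: ereal_proper_def)
  have nc: "fenchel_conj f a \<noteq> -\<infinity>" by (rule fenchel_conj_not_MInfty[OF f])
  have min: "\<beta>min > 0" using assms by simp
  have n: "0 < 1 + norm x + norm y" by (simp add: add_pos_nonneg)
  show "f x - optimal_value f A b \<le>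
      (ereal (1 + norm x) + ereal (sqrt (2 / \<eta>)) *
         ereal_sqrt (ereal (1 + norm x + norm y) * ereal_sqrt (projected_gap f A b (x, y))
                     + ereal (1 / (2 * \<beta>min)) * projected_gap f A b (x, y)))
      * ereal_sqrt (projected_gap f A b (x, y))"
  proof (cases "f x = \<infinity> \<or> fenchel_conj f a = \<infinity>")
    \<comment> \<open>Both sides are compared at \<open>P = \<infinity>\<close>: the coefficients on
      the right are strictly positive, so no product \<open>0 * \<infinity> = 0\<close> occurs and
      the right-hand side is \<infinity>.\<close>
    case True
    then have "f x + fenchel_conj f a + ereal (b \<bullet> y) = \<infinity>"
      using nx nc by auto
    then have "P = \<infinity>" by (simp only: P) (simp add: power2_eq_square)
    then show ?thesis
      unfolding P_def[symmetric] using assms(7) min n by (simp add: ereal_sqrt_def)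
  next
    case False
    then obtain \<phi> c where fx: "f x = ereal \<phi>" and c: "fenchel_conj f a = ereal c"
      using nx nc by (metis ereal_cases)
    define D where "D = (\<phi> + c + b \<bullet> y)\<^sup>2 + (norm (a + adjoint A y))\<^sup>2 + (norm (A x - b))\<^sup>2"
    have "P = ereal D"
      by (simp add: P fx c D_def)
    then show ?thesis
      using error_bound_estimate[OF f assms(2-5,7) _ fx c D_def] assms(6,8) z
      unfolding P_def[symmetric] by (simp add: ereal_sqrt_def)
  qed
qed

end
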